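(* Suppose $0<\kappa<\lambda_{\min}(C)$, where $\lambda_{\min}(C)$ is the minimal eigenvalue of $C$. Let $\Phi$ be any optimality criterion expressed as a concave, increasing and continuous real-valued function $M\mapsto\Phi(M)$ of the symmetric positive semidefinite $p\times p$ matrix $M$ (increasing with respect to the Löwner ordering). Then the mapping $$\xi\in\Xi\;\longmapsto\;\Phi\{M(\xi)\}$$ is concave on $\Xi$.
   Context: Let $\mathcal{X}=\{x_1,\dots,x_N\}$ be a finite set with $N$ points, let $n$ be an integer with $1\le n\le N$, and let $\kappa>0$. Let $C$ be an $N\times N$ (symmetric) covariance matrix and $F$ a real $N\times p$ matrix (with entries $F_{i,j}=f_j(x_i)$ for given regression functions $f_1,\dots,f_p$ on $\mathcal{X}$). Define the convex set of design measures $$\Xi=\Big\{\xi:\mathcal{X}\to\mathbb{R}\;:\;\sum_{x\in\mathcal{X}}\xi(x)=1,\;0\le\xi(x)\le 1/n\ \text{for all }x\in\mathcal{X}\Big\}.$$ For $\xi\in\Xi$ let $\operatorname{supp}(\xi)=\{x\in\mathcal{X}:\xi(x)>0\}$ and let $W(\xi)$ be the diagonal matrix, with rows and columns indexed by $\mathcal{X}$, whose diagonal entry at $x_i$ is $\kappa\,\frac{1/n-\xi(x_i)}{\xi(x_i)}$ (finite exactly when $x_i\in\operatorname{supp}(\xi)$). The information matrix is $$M(\xi)=F^{\top}\{C+W(\xi)\}^{-1}F\quad\text{if }\operatorname{supp}(\xi)=\mathcal{X},\qquad M(\xi)=F'^{\top}\{C'+W'(\xi)\}^{-1}F'\quad\text{if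 }\operatorname{supp}(\xi)\ne\mathcal{X},$$ where $C',W'(\xi)$ are the submatrices of $C,W(\xi)$ with rows and columns restricted to $\operatorname{supp}(\xi)$ and $F'$ is the submatrix of $F$ with rows restricted to $\operatorname{supp}(\xi)$. The Löwner ordering on symmetric matrices is $A\ge B$ iff $A-B$ is positive semidefinite; $\Phi$ is increasing if $A\ge B$ implies $\Phi(A)\ge\Phi(B)$. *)

theory Defs
  imports "HOL-Analysis.Analysis"
begin

definition psd_matrices :: "(real^'m^'m) set" where
  "psd_matrices = {A. transpose A = A \<and> (\<forall>v. 0 \<le> v \<bullet> (A *v v))}"

definition loewner_le :: "real^'m^'m \<Rightarrow> real^'m^'m \<Rightarrow> bool" where
  "loewner_le A B \<longleftrightarrow> B - A \<in> psd_matrices"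

(* Used for symmetric matrices, whose eigenvalues are all real. *)
definition eigenvalues :: "real^'m^'m \<Rightarrow> real set" where
  "eigenvalues A = {l. \<exists>v. v \<noteq> 0 \<and> A *v v = l *\<^sub>R v}"

definition min_eigenvalue :: "real^'m^'m \<Rightarrow> real" where
  "min_eigenvalue A = Min (eigenvalues A)"

definition design_measures :: "nat \<Rightarrow> (real^'x) set" where
  "design_measures n =
     {\<xi>. (\<Sum>x\<in>UNIV. \<xi> $ x) = 1 \<and> (\<forall>x. 0 \<le> \<xi> $ x \<and> \<xi> $ x \<le> 1 / real n)}"

definition design_support :: "real^'x \<Rightarrow> 'x set" where
  "design_support \<xi> = {x. \<xi> $ x > 0}"

(* Diagonal entries off the support are meaningless (division by zero) and are never used. *)
definition weight_matrix :: "real \<Rightarrow> nat \<Rightarrow> real^'x \<Rightarrow> real^'x^'x" where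
  "weight_matrix \<kappa> n \<xi> =
     (\<chi> x y. if x = y then \<kappa> * ((1 / real n - \<xi> $ x) / \<xi> $ x) else 0)"

(* The dimensions of the matrix type are fixed by the type, so an S-by-S matrix is represented
   by the entries with indices in S of a full matrix; the other entries are arbitrary.
   "submatrix_inv S A" is the inverse of the submatrix of A with rows and columns in S. *)
definition is_submatrix_inv :: "'x set \<Rightarrow> real^'x^'x \<Rightarrow> real^'x^'x \<Rightarrow> bool" where
  "is_submatrix_inv S A B \<longleftrightarrow>
     (\<forall>x\<in>S. \<forall>y\<in>S. (\<Sum>z\<in>S. A $ x $ z * B $ z $ y) = (if x = y then 1 else 0)) \<and>
     (\<forall>x\<in>S. \<forall>y\<in>S. (\<Sum>z\<in>S. B $ x $ z * A $ z $ y) = (if x = y then 1 else 0))"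

definition submatrix_inv :: "'x set \<Rightarrow> real^'x^'x \<Rightarrow> real^'x^'x" where
  "submatrix_inv S A = (SOME B. is_submatrix_inv S A B)"

lemma submatrix_inv_unique:
  fixes A B :: "real^'x^'x"
  assumes B: "is_submatrix_inv S A B" and xy: "x \<in> S" "y \<in> S"
  shows "submatrix_inv S A $ x $ y = B $ x $ y"
proof -
  define G where "G = submatrix_inv S A"
  have G: "is_submatrix_inv S A G"
    unfolding G_def submatrix_inv_def using B by (rule someI)
  have "G $ x $ y = (\<Sum>z\<in>S. G $ x $ z * (if z = y then 1 else 0))"
    using xy by (simp add: if_distrib cong: if_cong)
  also have "\<dots> = (\<Sum>z\<in>S. G $ x $ z * (\<Sum>w\<in>S. A $ z $ w * B $ w $ y))"
    using B xy by (intro sum.cong) (auto simp: is_submatrix_inv_def)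
  also have "\<dots> = (\<Sum>z\<in>S. \<Sum>w\<in>S. G $ x $ z * A $ z $ w * B $ w $ y)"
    by (simp add: sum_distrib_left mult.assoc)
  also have "\<dots> = (\<Sum>w\<in>S. \<Sum>z\<in>S. G $ x $ z * A $ z $ w * B $ w $ y)"
    by (rule sum.swap)
  also have "\<dots> = (\<Sum>w\<in>S. (\<Sum>z\<in>S. G $ x $ z * A $ z $ w) * B $ w $ y)"
    by (simp add: sum_distrib_right)
  also have "\<dots> = (\<Sum>w\<in>S. (if x = w then 1 else 0) * B $ w $ y)"
    using G xy by (intro sum.cong) (auto simp: is_submatrix_inv_def)
  also have "\<dots> = B $ x $ y"
    using xy by (simp add: if_distrib if_distribR cong: if_cong)
  finally show ?thesis by (simp add: G_def)
qed

lemma submatrix_inv_UNIV: "submatrix_inv UNIV A = matrix_inv A"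
  unfolding submatrix_inv_def matrix_inv_def is_submatrix_inv_def
  by (simp add: vec_eq_iff matrix_matrix_mult_def mat_def)

(* Rows of F, and rows and columns of C and of the weights, restricted to the support. *)
definition info_matrix ::
  "real \<Rightarrow> nat \<Rightarrow> real^'x^'x \<Rightarrow> real^'p^'x \<Rightarrow> real^'x \<Rightarrow> real^'p^'p" where
  "info_matrix \<kappa> n C F \<xi> =
     (let S = design_support \<xi>; G = submatrix_inv S (C + weight_matrix \<kappa> n \<xi>)
      in \<chi> i j. \<Sum>x\<in>S. \<Sum>y\<in>S. F $ x $ i * G $ x $ y * F $ y $ j)"

lemma info_matrix_full_support:
  assumes "design_support \<xi> = UNIV"
  shows "info_matrix \<kappa> n C F \<xi> =
    transpose F ** matrix_inv (C + weight_matrix \<kappa> n \<xi>) ** F"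
  unfolding info_matrix_def Let_def assms submatrix_inv_UNIV
  by (simp add: vec_eq_iff matrix_matrix_mult_def transpose_def sum_distrib_right)
     (intro allI sum.swap)

end

theory Submission
  imports Defs
begin

text \<open>
  With \<open>A = C - \<kappa> I\<close>, which is positive definite, \<open>C + W(\<xi>)\<close> is on the support equal to
  \<open>A + (\<kappa>/n) diag(1/\<xi>)\<close>. Hence the quadratic form \<open>w\<^sup>T (C' + W'(\<xi>))\<^sup>-\<^sup>1 w\<close> is the parallel sum of
  \<open>A\<^sup>-\<^sup>1\<close> and \<open>(n/\<kappa>) diag(\<xi>)\<close>, that is, the minimum over \<open>y\<close> of
  \<open>y\<^sup>T A y + (n/\<kappa>) \<Sum>\<^sub>x \<xi>(x) (w - A y)(x)\<^sup>2\<close>, attained at \<open>y = (C' + W'(\<xi>))\<^sup>-\<^sup>1 w\<close> extended by zero off the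
  support; the stationarity condition holds there too, since both sides vanish. As a minimum of functions that are affine
  in \<open>\<xi>\<close> it is concave, so \<open>M\<close> is concave in the Loewner order.
\<close>

section \<open>Quadratic forms and the minimal eigenvalue of a symmetric matrix\<close>

lemma inner_symmetric_matrix:
  fixes A :: "real^'m^'m"
  assumes "transpose A = A"
  shows "u \<bullet> (A *v v) = v \<bullet> (A *v u)"
  by (metis assms dot_lmul_matrix inner_commute transpose_matrix_vector)

lemma psd_matricesI:
  assumes "transpose A = A" "\<And>v. 0 \<le> v \<bullet> (A *v v)"
  shows "A \<in> psd_matrices"
  using assms by (simp add: psd_matrices_def)

text \<open>A zero of the form is a minimum of it, so the gradient there vanishes: otherwise a short
  step from \<open>v\<close> against \<open>A *v v\<close> would make the form negative.\<close>

lemma psd_quadratic_form_zero_imp_kernel: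
  fixes A :: "real^'m^'m"
  assumes A: "A \<in> psd_matrices" and v: "v \<bullet> (A *v v) = 0"
  shows "A *v v = 0"
proof (rule ccontr)
  assume nz: "A *v v \<noteq> 0"
  define w where "w = A *v v"
  define a where "a = w \<bullet> w"
  define b where "b = w \<bullet> (A *v w)"
  have sym: "transpose A = A" and pos: "\<And>v. 0 \<le> v \<bullet> (A *v v)"
    using A by (auto simp: psd_matrices_def)
  have a: "a > 0" using nz by (simp add: a_def w_def)
  have b: "b \<ge> 0" using pos by (simp add: b_def)
  have eq: "(v - s *\<^sub>R w) \<bullet> (A *v (v - s *\<^sub>R w)) = s * (s * b - 2 * a)" for s
  proof -
    have "v \<bullet> (A *v w) = a"
      by (subst inner_symmetric_matrix[OF sym]) (simp add: a_def w_def)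
    then show ?thesis
      using v by (simp add: matrix_vector_mult_diff_distrib matrix_vector_mult_scaleR
          inner_diff_left inner_diff_right a_def b_def flip: w_def)
        (simp add: algebra_simps)
  qed
  \<comment> \<open>This step length gives \<open>s * b \<le> a\<close>, so the linear term
    outweighs the quadratic one; the 1 keeps the denominator positive when
    \<open>b = 0\<close>.\<close>
  define s where "s = a / (b + 1)"
  have s: "s > 0" using a b by (simp add: s_def)
  have "s * b \<le> a" using a b by (simp add: s_def field_simps)
  then have "s * (s * b - 2 * a) < 0" using s a by (simp add: mult_pos_neg)
  then show False using pos[of "v - s *\<^sub>R w"] by (simp add: eq)
qed

text \<open>Eigenvectors for distinct eigenvalues are orthogonal, and a pairwise orthogonal set is
  finite. Finiteness makes the \<open>Min\<close> in \<open>min_eigenvalue\<close> a lower bound of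
  the spectrum.\<close>

lemma finite_eigenvalues_symmetric:
  fixes A :: "real^'m^'m"
  assumes sym: "transpose A = A"
  shows "finite (eigenvalues A)"
proof -
  have "\<forall>l\<in>eigenvalues A. \<exists>v. v \<noteq> 0 \<and> A *v v = l *\<^sub>R v"
    by (simp add: eigenvalues_def)
  then obtain f where f: "\<And>l. l \<in> eigenvalues A \<Longrightarrow> f l \<noteq> 0 \<and> A *v f l = l *\<^sub>R f l"
    by (metis bchoice)
  have orth: "f l \<bullet> f k = 0" if "l \<in> eigenvalues A" "k \<in> eigenvalues A" "l \<noteq> k" for l k
    using inner_symmetric_matrix[OF sym, of "f l" "f k"] f[OF that(1)] f[OF that(2)] that(3)
    by (simp add: inner_commute)
  have inj: "inj_on f (eigenvalues A)"
    by (rule inj_onI) (metis f inner_eq_zero_iff orth)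
  have "pairwise orthogonal (f ` eigenvalues A)"
    by (auto simp: pairwise_def orthogonal_def intro!: orth)
  then have "finite (f ` eigenvalues A)"
    by (rule pairwise_orthogonal_imp_finite)
  with inj show ?thesis by (simp add: finite_image_iff)
qed

lemma quadratic_form_shift:
  fixes A :: "real^'m^'m"
  shows "v \<bullet> ((A - mat c) *v v) = v \<bullet> (A *v v) - c * (v \<bullet> v)"
proof -
  have "mat c *v v = c *\<^sub>R v"
    by (simp add: vec_eq_iff matrix_vector_mult_def mat_def if_distrib if_distribR cong: if_cong)
  then show ?thesis
    by (simp add: matrix_vector_mult_diff_rdistrib inner_diff_right)
qed

lemma transpose_diff_mat:
  fixes A :: "real^'m^'m"
  assumes "transpose A = A"
  shows "transpose (A - mat c) = A - mat c"
  using assms by (auto simp: vec_eq_iff transpose_def mat_def)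

text \<open>By compactness the form attains its minimum \<open>m\<close> over the unit sphere at
  some \<open>e\<close>. Then \<open>A - mat m\<close> is positive semidefinite with a zero at
  \<open>e\<close>, so \<open>e\<close> is an eigenvector and \<open>m\<close> is an eigenvalue of
  \<open>A\<close>.\<close>

lemma min_eigenvalue_le_rayleigh:
  fixes A :: "real^'m^'m"
  assumes sym: "transpose A = A"
  shows "min_eigenvalue A * (v \<bullet> v) \<le> v \<bullet> (A *v v)"
proof -
  let ?q = "\<lambda>v. v \<bullet> (A *v v)"
  let ?S = "sphere (0::real^'m) 1"
  have "continuous_on ?S ?q"
    by (intro continuous_intros matrix_vector_mult_linear_continuous_on)
  moreover have "?S \<noteq> {}" by simp
  ultimately have "\<exists>e\<in>?S. \<forall>v\<in>?S. ?q e \<le> ?q v"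
    by (intro continuous_attains_inf compact_sphere)
  then obtain e where e: "e \<in> ?S" and emin: "\<And>v. v \<in> ?S \<Longrightarrow> ?q e \<le> ?q v"
    by blast
  define m where "m = ?q e"
  have rayleigh: "m * (v \<bullet> v) \<le> ?q v" for v
  proof (cases "v = 0")
    case False
    then have "m \<le> ?q (v /\<^sub>R norm v)"
      unfolding m_def by (intro emin) simp
    also have "\<dots> = ?q v / (v \<bullet> v)"
      by (simp add: matrix_vector_mult_scaleR divide_simps flip: power2_norm_eq_inner)
        (simp add: power2_eq_square)
    finally show ?thesis using False by (simp add: field_simps)
  qed simp
  have "A - mat m \<in> psd_matrices"
    using rayleigh sym by (intro psd_matricesI) (auto simp: quadratic_form_shift transpose_diff_mat)
  moreover have "e \<bullet> ((A - mat m) *v e) = 0"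
    using e by (simp add: quadratic_form_shift m_def dot_square_norm)
  ultimately have "(A - mat m) *v e = 0"
    by (rule psd_quadratic_form_zero_imp_kernel)
  then have "A *v e = m *\<^sub>R e"
    by (simp add: matrix_vector_mult_diff_rdistrib) 
      (simp add: vec_eq_iff matrix_vector_mult_def mat_def if_distrib if_distribR cong: if_cong)
  moreover have "e \<noteq> 0" using e by auto
  ultimately have "m \<in> eigenvalues A" by (auto simp: eigenvalues_def)
  then have "min_eigenvalue A \<le> m"
    unfolding min_eigenvalue_def by (intro Min_le finite_eigenvalues_symmetric sym)
  then have "min_eigenvalue A * (v \<bullet> v) \<le> m * (v \<bullet> v)"
    by (intro mult_right_mono) auto
  also have "\<dots> \<le> v \<bullet> (A *v v)" by (rule rayleigh)
  finally show ?thesis .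
qed

section \<open>Inverses of principal submatrices\<close>

lemma is_submatrix_inv_submatrix_inv:
  assumes "is_submatrix_inv S A B"
  shows "is_submatrix_inv S A (submatrix_inv S A)"
  unfolding submatrix_inv_def using assms by (rule someI)

text \<open>Positivity on the nonzero vectors supported in \<open>S\<close> rules out a kernel of
  the \<open>S\<close>-block.\<close>

lemma submatrix_inv_exists:
  fixes A :: "real^'x^'x"
  assumes pos: "\<And>v. v \<noteq> 0 \<Longrightarrow> (\<And>x. x \<notin> S \<Longrightarrow> v $ x = 0) \<Longrightarrow> 0 < v \<bullet> (A *v v)"
  shows "\<exists>B. is_submatrix_inv S A B"
proof -
  \<comment> \<open>\<open>K\<close> pads the \<open>S\<close>-block of \<open>A\<close> with the
    identity. It is block diagonal, so ordinary invertibility applies to it, and the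
    \<open>S\<close>-block of its inverse inverts that of \<open>A\<close>.\<close>
  define K :: "real^'x^'x" where
    "K = (\<chi> x y. if x \<in> S \<and> y \<in> S then A $ x $ y else if x = y then 1 else 0)"
  have ker: "v = 0" if Kv: "K *v v = 0" for v
  proof (rule ccontr)
    assume v: "v \<noteq> 0"
    have off: "v $ x = 0" if "x \<notin> S" for x
    proof -
      have "(K *v v) $ x = (\<Sum>y\<in>UNIV. if y = x then v $ y else 0)"
        unfolding matrix_vector_mult_def vec_lambda_beta
        using that by (intro sum.cong) (auto simp: K_def)
      with Kv show ?thesis by simp
    qed
    have "(K *v v) $ x = (A *v v) $ x" if "x \<in> S" for x
      using that off
      by (auto simp: matrix_vector_mult_def K_def intro!: sum.cong)
    then have "v $ x * (A *v v) $ x = 0" for x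
      using Kv off by (cases "x \<in> S") auto
    then have "v \<bullet> (A *v v) = 0"
      unfolding inner_vec_def inner_real_def by (simp only: sum.neutral_const)
    with pos[OF v off] show False by simp
  qed
  then obtain B where BK: "B ** K = mat 1"
    using matrix_left_invertible_ker by blast
  then have KB: "K ** B = mat 1"
    by (simp add: matrix_left_right_inverse)
  have restrict: "(\<Sum>z\<in>S. h z) = (\<Sum>z\<in>UNIV. if z \<in> S then h z else 0)" for h :: "'x \<Rightarrow> real"
    by (simp add: sum.If_cases)
  have "is_submatrix_inv S A B"
    unfolding is_submatrix_inv_def
  proof (intro conjI ballI)
    fix x y assume xy: "x \<in> S" "y \<in> S"
    have "(\<Sum>z\<in>S. A $ x $ z * B $ z $ y) = (K ** B) $ x $ y"
      unfolding restrict matrix_matrix_mult_def using xy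
      by (auto simp: K_def intro!: sum.cong)
    then show "(\<Sum>z\<in>S. A $ x $ z * B $ z $ y) = (if x = y then 1 else 0)"
      by (simp add: KB mat_def)
    have "(\<Sum>z\<in>S. B $ x $ z * A $ z $ y) = (B ** K) $ x $ y"
      unfolding restrict matrix_matrix_mult_def using xy
      by (auto simp: K_def intro!: sum.cong)
    then show "(\<Sum>z\<in>S. B $ x $ z * A $ z $ y) = (if x = y then 1 else 0)"
      by (simp add: BK mat_def)
  qed
  then show ?thesis ..
qed

text \<open>The transpose of an inverse of a symmetric block is again an inverse of it, and inverses
  agree on \<open>S\<close>. Off \<open>S\<close> the chosen matrix is arbitrary, hence the
  restriction on \<open>x\<close> and \<open>y\<close>.\<close>

lemma submatrix_inv_symmetric:
  fixes A :: "real^'x^'x"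
  assumes B: "is_submatrix_inv S A B" and sym: "transpose A = A" and xy: "x \<in> S" "y \<in> S"
  shows "submatrix_inv S A $ x $ y = submatrix_inv S A $ y $ x"
proof -
  let ?G = "submatrix_inv S A"
  have A: "A $ x $ y = A $ y $ x" for x y
    using sym by (metis transpose_def vec_lambda_beta)
  have "is_submatrix_inv S A ?G"
    using B by (rule is_submatrix_inv_submatrix_inv)
  then have "is_submatrix_inv S A (transpose ?G)"
    unfolding is_submatrix_inv_def
    by (auto simp: transpose_def A mult.commute[of "A $ _ $ _"])
  from submatrix_inv_unique[OF this xy] show ?thesis
    by (simp add: transpose_def)
qed

section \<open>The parallel-sum functional and its minimum\<close>

text \<open>The parallel sum minimises over splittings of \<open>w\<close> into two parts; here the
  part charged with the inverse of \<open>A\<close> is written as \<open>A *v y\<close>. Thus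
  neither \<open>A\<close> nor \<open>\<xi>\<close> is inverted, and one formula serves designs with
  different supports.\<close>

definition parallel_form ::
    "real \<Rightarrow> nat \<Rightarrow> real^'x^'x \<Rightarrow> real^'x \<Rightarrow> real^'x \<Rightarrow> real^'x \<Rightarrow> real" where
  "parallel_form \<kappa> n A \<xi> w y =
     y \<bullet> (A *v y) + real n / \<kappa> * (\<Sum>x\<in>UNIV. \<xi> $ x * ((w - A *v y) $ x)\<^sup>2)"

text \<open>Only the weighted sum depends on the design, and it does so linearly. This is the source
  of concavity.\<close>

lemma parallel_form_affine:
  assumes "a + b = 1"
  shows "parallel_form \<kappa> n A (a *\<^sub>R \<xi> + b *\<^sub>R \<eta>) w y =
    a * parallel_form \<kappa> n A \<xi> w y + b * parallel_form \<kappa> n A \<eta> w y"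
proof -
  have "y \<bullet> (A *v y) = a * (y \<bullet> (A *v y)) + b * (y \<bullet> (A *v y))"
    using assms by (simp flip: distrib_right)
  then show ?thesis
    unfolding parallel_form_def
    by (simp add: distrib_left distrib_right sum.distrib sum_distrib_left mult_ac)
qed

text \<open>The functional is quadratic in \<open>y\<close>, so its expansion around
  \<open>g\<close> is exact. The hypothesis on \<open>g\<close> makes the first-order terms cancel,
  and the remainder is nonnegative.\<close>

lemma parallel_form_stationary_min:
  fixes A :: "real^'x^'x"
  assumes A: "A \<in> psd_matrices" and \<kappa>: "0 < \<kappa>" and \<xi>: "\<And>x. 0 \<le> \<xi> $ x"
    and g: "\<And>x. real n / \<kappa> * \<xi> $ x * (w - A *v g) $ x = g $ x"
  shows "parallel_form \<kappa> n A \<xi> w g = w \<bullet> g"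
    and "w \<bullet> g \<le> parallel_form \<kappa> n A \<xi> w y"
proof -
  define z where "z = w - A *v g"
  have sym: "transpose A = A" and pos: "\<And>v. 0 \<le> v \<bullet> (A *v v)"
    using A by (auto simp: psd_matrices_def)
  have gz: "real n / \<kappa> * (\<xi> $ x * (z $ x * r)) = g $ x * r" for x r
    unfolding g[symmetric] z_def by (simp add: mult_ac)
  show val: "parallel_form \<kappa> n A \<xi> w g = w \<bullet> g"
  proof -
    have "real n / \<kappa> * (\<Sum>x\<in>UNIV. \<xi> $ x * (z $ x)\<^sup>2) = g \<bullet> z"
      unfolding sum_distrib_left power2_eq_square gz by (simp add: inner_vec_def)
    then show ?thesis
      unfolding parallel_form_def z_def[symmetric]
      by (simp add: z_def inner_diff_right inner_commute)
  qed
  define k where "k = y - g"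
  define h where "h = A *v k"
  have y: "y = g + k" by (simp add: k_def)
  have zy: "w - A *v y = z - h"
    by (simp add: z_def h_def y matrix_vector_right_distrib)
  have sq: "\<xi> $ x * ((z - h) $ x)\<^sup>2
      = \<xi> $ x * (z $ x * z $ x) - 2 * (\<xi> $ x * (z $ x * h $ x)) + \<xi> $ x * (h $ x)\<^sup>2" for x
    by (simp add: power2_eq_square algebra_simps)
  \<comment> \<open>Stationarity turns weighted products with the residual \<open>z\<close> into
    inner products with \<open>g\<close>. The cross term of the squares thereby becomes
    \<open>- 2 * (g \<bullet> h)\<close>, which cancels the one coming from
    \<open>y \<bullet> (A *v y)\<close>.\<close>
  have lin: "real n / \<kappa> * (\<Sum>x\<in>UNIV. \<xi> $ x * (z $ x * r $ x)) = g \<bullet> r" for r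
    unfolding sum_distrib_left gz by (simp add: inner_vec_def)
  have "real n / \<kappa> * (\<Sum>x\<in>UNIV. \<xi> $ x * ((z - h) $ x)\<^sup>2) =
      g \<bullet> z - 2 * (g \<bullet> h) + real n / \<kappa> * (\<Sum>x\<in>UNIV. \<xi> $ x * (h $ x)\<^sup>2)"
    unfolding sq sum.distrib sum_subtractf lin[symmetric]
    by (simp add: algebra_simps sum_distrib_left)
  moreover have "y \<bullet> (A *v y) = g \<bullet> (A *v g) + 2 * (g \<bullet> h) + k \<bullet> (A *v k)"
    using inner_symmetric_matrix[OF sym, of k g]
    by (simp add: y h_def matrix_vector_right_distrib inner_add_left inner_add_right)
  moreover have "w \<bullet> g = g \<bullet> (A *v g) + g \<bullet> z"
    by (simp add: z_def inner_diff_right inner_commute)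
  ultimately have "parallel_form \<kappa> n A \<xi> w y =
      w \<bullet> g + (k \<bullet> (A *v k) + real n / \<kappa> * (\<Sum>x\<in>UNIV. \<xi> $ x * (h $ x)\<^sup>2))"
    unfolding parallel_form_def zy by simp
  moreover have "0 \<le> real n / \<kappa> * (\<Sum>x\<in>UNIV. \<xi> $ x * (h $ x)\<^sup>2)"
    using \<kappa> \<xi> by (intro mult_nonneg_nonneg sum_nonneg) auto
  ultimately show "w \<bullet> g \<le> parallel_form \<kappa> n A \<xi> w y"
    using pos[of k] by simp
qed

section \<open>The information matrix as a minimum\<close>

lemma info_matrix_quadratic_form:
  fixes F :: "real^'p^'x"
  defines "w u \<equiv> F *v u"
  shows "u \<bullet> (info_matrix \<kappa> n C F \<xi> *v u) =
    (\<Sum>x\<in>design_support \<xi>. \<Sum>y\<in>design_support \<xi>.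
       w u $ x * submatrix_inv (design_support \<xi>) (C + weight_matrix \<kappa> n \<xi>) $ x $ y * w u $ y)"
proof -
  let ?S = "design_support \<xi>"
  let ?G = "submatrix_inv ?S (C + weight_matrix \<kappa> n \<xi>)"
  have "u \<bullet> (info_matrix \<kappa> n C F \<xi> *v u) =
      (\<Sum>i\<in>UNIV. \<Sum>j\<in>UNIV. \<Sum>x\<in>?S. \<Sum>y\<in>?S. u $ i * F $ x $ i * ?G $ x $ y * (F $ y $ j * u $ j))"
    by (simp add: inner_vec_def matrix_vector_mult_def info_matrix_def Let_def
        sum_distrib_left sum_distrib_right mult_ac)
  also have "\<dots> = (\<Sum>i\<in>UNIV. \<Sum>x\<in>?S. \<Sum>y\<in>?S. \<Sum>j\<in>UNIV. u $ i * F $ x $ i * ?G $ x $ y * (F $ y $ j * u $ j))"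
    by (intro sum.cong refl, subst sum.swap, intro sum.cong refl, rule sum.swap)
  also have "\<dots> = (\<Sum>x\<in>?S. \<Sum>y\<in>?S. \<Sum>i\<in>UNIV. \<Sum>j\<in>UNIV. u $ i * F $ x $ i * ?G $ x $ y * (F $ y $ j * u $ j))"
    by (subst sum.swap, intro sum.cong refl, rule sum.swap)
  also have "\<dots> = (\<Sum>x\<in>?S. \<Sum>y\<in>?S. w u $ x * ?G $ x $ y * w u $ y)"
    by (simp add: w_def matrix_vector_mult_def sum_distrib_left sum_distrib_right mult_ac)
  finally show ?thesis .
qed

text \<open>The diagonal weight is \<open>\<kappa> / (real n * \<xi> $ x) - \<kappa>\<close>. Moving
  the constant into \<open>C\<close> leaves a diagonal that is proportional to the reciprocal of the
  design.\<close>

lemma weight_matrix_decomposition: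
  assumes "\<xi> $ x > 0"
  shows "(C + weight_matrix \<kappa> n \<xi>) $ x $ y =
    (C - mat \<kappa>) $ x $ y + (if x = y then \<kappa> / (real n * \<xi> $ x) else 0)"
proof -
  have "\<kappa> * ((1 / real n - \<xi> $ x) / \<xi> $ x) = \<kappa> / (real n * \<xi> $ x) - \<kappa>"
    using assms by (simp add: diff_divide_distrib right_diff_distrib)
  then show ?thesis by (auto simp: weight_matrix_def mat_def)
qed

text \<open>On vectors supported in the design support the form splits into that of
  \<open>C - mat \<kappa>\<close>, which is nonnegative, and a diagonal part with entries
  \<open>\<kappa> / (real n * \<xi> $ x)\<close>, which is strictly positive.\<close>

lemma design_submatrix_invertible:
  assumes A: "C - mat \<kappa> \<in> psd_matrices" and \<kappa>: "0 < \<kappa>" and n: "1 \<le> n"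
  shows "\<exists>B. is_submatrix_inv (design_support \<xi>) (C + weight_matrix \<kappa> n \<xi>) B"
proof (rule submatrix_inv_exists)
  let ?A = "C - mat \<kappa>" and ?S = "design_support \<xi>"
  fix v :: "real^'a" assume v: "v \<noteq> 0" and off: "\<And>x. x \<notin> ?S \<Longrightarrow> v $ x = 0"
  \<comment> \<open>The factor \<open>v $ x\<close> makes both sides vanish off the support,
    whatever the meaningless diagonal entries are there.\<close>
  have comp: "v $ x * ((C + weight_matrix \<kappa> n \<xi>) *v v) $ x =
      v $ x * (?A *v v) $ x + \<kappa> / (real n * \<xi> $ x) * (v $ x)\<^sup>2" for x
  proof (cases "x \<in> ?S")
    case True
    then have "\<xi> $ x > 0" by (simp add: design_support_def)
    then have "((C + weight_matrix \<kappa> n \<xi>) *v v) $ x =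
        (?A *v v) $ x + \<kappa> / (real n * \<xi> $ x) * v $ x"
      unfolding matrix_vector_mult_def vec_lambda_beta
      by (simp only: weight_matrix_decomposition ring_distribs sum.distrib)
        (simp add: if_distrib if_distribR cong: if_cong)
    then show ?thesis by (simp only: power2_eq_square distrib_left mult_ac)
  qed (simp add: off)
  have nonneg: "0 \<le> \<kappa> / (real n * \<xi> $ x) * (v $ x)\<^sup>2" for x
    using off[of x] \<kappa> by (cases "x \<in> ?S") (auto simp: design_support_def)
  obtain x where x: "v $ x \<noteq> 0" using v by (auto simp: vec_eq_iff)
  then have "\<xi> $ x > 0" using off by (auto simp: design_support_def)
  then have "0 < \<kappa> / (real n * \<xi> $ x) * (v $ x)\<^sup>2" using \<kappa> n x by simp
  then have "0 < (\<Sum>x\<in>UNIV. \<kappa> / (real n * \<xi> $ x) * (v $ x)\<^sup>2)"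
    using nonneg by (intro sum_pos2[of _ x]) auto
  moreover have "v \<bullet> ((C + weight_matrix \<kappa> n \<xi>) *v v) =
      v \<bullet> (?A *v v) + (\<Sum>x\<in>UNIV. \<kappa> / (real n * \<xi> $ x) * (v $ x)\<^sup>2)"
    by (simp add: inner_vec_def comp sum.distrib del: vector_add_component)
  moreover have "0 \<le> v \<bullet> (?A *v v)" using A by (simp add: psd_matrices_def)
  ultimately show "0 < v \<bullet> ((C + weight_matrix \<kappa> n \<xi>) *v v)" by simp
qed

text \<open>The two conclusions together express a minimum. For concavity, attainment is used at the
  mixed design and the upper bound at the two designs being mixed.\<close>

lemma info_matrix_variational:
  fixes C :: "real^'x^'x" and F :: "real^'p^'x" and u :: "real^'p"
  assumes A: "C - mat \<kappa> \<in> psd_matrices" and \<kappa>: "0 < \<kappa>" and n: "1 \<le> n"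
    and \<xi>: "\<And>x. 0 \<le> \<xi> $ x"
  defines "J \<equiv> parallel_form \<kappa> n (C - mat \<kappa>) \<xi> (F *v u)"
  shows "\<exists>g. u \<bullet> (info_matrix \<kappa> n C F \<xi> *v u) = J g"
    and "u \<bullet> (info_matrix \<kappa> n C F \<xi> *v u) \<le> J y"
proof -
  let ?A = "C - mat \<kappa>" and ?S = "design_support \<xi>" and ?K = "C + weight_matrix \<kappa> n \<xi>"
  let ?w = "F *v u"
  define G where "G = submatrix_inv ?S ?K"
  have G: "is_submatrix_inv ?S ?K G"
    unfolding G_def using design_submatrix_invertible[OF A \<kappa> n]
    by (auto intro: is_submatrix_inv_submatrix_inv)
  define g where "g = (\<chi> x. if x \<in> ?S then \<Sum>y\<in>?S. G $ x $ y * ?w $ y else 0)"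
  have restrict: "(\<Sum>z\<in>UNIV. if z \<in> ?S then h z else 0) = (\<Sum>z\<in>?S. h z)" for h :: "'x \<Rightarrow> real"
    by (simp add: sum.If_cases)
  have form: "u \<bullet> (info_matrix \<kappa> n C F \<xi> *v u) = ?w \<bullet> g"
    unfolding info_matrix_quadratic_form G_def[symmetric]
    by (simp add: inner_vec_def g_def if_distrib restrict sum_distrib_left mult_ac cong: if_cong)
  have stat: "real n / \<kappa> * \<xi> $ x * (?w - ?A *v g) $ x = g $ x" for x
  proof (cases "x \<in> ?S")
    case False
    then have "\<xi> $ x = 0" using \<xi>[of x] by (simp add: design_support_def)
    with False show ?thesis by (simp add: g_def)
  next
    case True
    then have pos: "\<xi> $ x > 0" by (simp add: design_support_def)
    \<comment> \<open>As \<open>g\<close> vanishes off the support, row \<open>x\<close> of the full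
      product sees only the block inverted by \<open>G\<close>, so it returns
      \<open>?w $ x\<close>.\<close>
    have "(?K *v g) $ x = (\<Sum>z\<in>?S. ?K $ x $ z * (\<Sum>y\<in>?S. G $ z $ y * ?w $ y))"
      by (simp add: matrix_vector_mult_def g_def if_distrib restrict
          del: vector_add_component cong: if_cong)
    also have "\<dots> = (\<Sum>y\<in>?S. \<Sum>z\<in>?S. ?K $ x $ z * G $ z $ y * ?w $ y)"
      unfolding sum_distrib_left by (subst sum.swap) (simp add: mult.assoc)
    also have "\<dots> = (\<Sum>y\<in>?S. (if x = y then 1 else 0) * ?w $ y)"
      using G True unfolding is_submatrix_inv_def by (simp flip: sum_distrib_right)
    also have "\<dots> = ?w $ x"
      using True by (simp add: if_distrib if_distribR cong: if_cong)
    finally have "(?K *v g) $ x = ?w $ x" .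
    \<comment> \<open>Comparing the two values of \<open>(?K *v g) $ x\<close> gives the residual as
      \<open>\<kappa> / (real n * \<xi> $ x) * g $ x\<close>, which is stationarity.\<close>
    moreover have "(?K *v g) $ x = (?A *v g) $ x + \<kappa> / (real n * \<xi> $ x) * g $ x"
      unfolding matrix_vector_mult_def vec_lambda_beta
      by (simp only: weight_matrix_decomposition[OF pos] ring_distribs sum.distrib)
        (simp add: if_distrib if_distribR cong: if_cong)
    ultimately have "(?w - ?A *v g) $ x = \<kappa> / (real n * \<xi> $ x) * g $ x" by simp
    then show ?thesis using pos \<kappa> n by (simp del: vector_minus_component)
  qed
  note min = parallel_form_stationary_min[OF A \<kappa> \<xi> stat]
  show "\<exists>g. u \<bullet> (info_matrix \<kappa> n C F \<xi> *v u) = J g"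
    unfolding form J_def using min(1)[symmetric] by (rule exI)
  show "u \<bullet> (info_matrix \<kappa> n C F \<xi> *v u) \<le> J y"
    using min(2) by (simp add: form J_def)
qed

text \<open>Symmetry is inherited from the submatrix inverse, and nonnegativity holds because the
  form is a value of the nonnegative \<open>parallel_form\<close>. Membership is needed since the
  assumptions on the criterion speak only of \<open>psd_matrices\<close>.\<close>

lemma info_matrix_psd:
  assumes A: "C - mat \<kappa> \<in> psd_matrices" and \<kappa>: "0 < \<kappa>" and n: "1 \<le> n"
    and \<xi>: "\<And>x. 0 \<le> \<xi> $ x"
  shows "info_matrix \<kappa> n C F \<xi> \<in> psd_matrices"
proof (rule psd_matricesI)
  let ?S = "design_support \<xi>" and ?K = "C + weight_matrix \<kappa> n \<xi>"
  let ?G = "submatrix_inv ?S ?K"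
  obtain B where B: "is_submatrix_inv ?S ?K B"
    using design_submatrix_invertible[OF A \<kappa> n] by blast
  have "C $ y $ x = C $ x $ y" for x y
  proof -
    have "transpose (C - mat \<kappa>) $ x $ y = (C - mat \<kappa>) $ x $ y"
      using A by (simp add: psd_matrices_def)
    then show ?thesis by (auto simp: mat_def transpose_def split: if_splits)
  qed
  then have "transpose ?K = ?K"
    by (auto simp: vec_eq_iff transpose_def weight_matrix_def)
  from submatrix_inv_symmetric[OF B this]
  have "(\<Sum>x\<in>?S. \<Sum>y\<in>?S. F $ x $ j * ?G $ x $ y * F $ y $ i) =
      (\<Sum>x\<in>?S. \<Sum>y\<in>?S. F $ x $ i * ?G $ x $ y * F $ y $ j)" for i j
    by (subst sum.swap) (auto intro!: sum.cong)
  then show "transpose (info_matrix \<kappa> n C F \<xi>) = info_matrix \<kappa> n C F \<xi>"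
    by (simp add: vec_eq_iff transpose_def info_matrix_def Let_def)
  fix u
  obtain g where "u \<bullet> (info_matrix \<kappa> n C F \<xi> *v u) = parallel_form \<kappa> n (C - mat \<kappa>) \<xi> (F *v u) g"
    using info_matrix_variational(1)[OF A \<kappa> n \<xi>] by blast
  also have "\<dots> \<ge> 0"
    unfolding parallel_form_def using A \<kappa> \<xi>
    by (intro add_nonneg_nonneg mult_nonneg_nonneg sum_nonneg) (auto simp: psd_matrices_def)
  finally show "0 \<le> u \<bullet> (info_matrix \<kappa> n C F \<xi> *v u)" .
qed

section \<open>Concavity in the Loewner order and of the criterion\<close>

lemma convex_psd_matrices: "convex (psd_matrices :: (real^'m^'m) set)"
proof (rule convexI)
  fix A B :: "real^'m^'m" and a b :: real
  assume AB: "A \<in> psd_matrices" "B \<in> psd_matrices" "0 \<le> a" "0 \<le> b"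
  show "a *\<^sub>R A + b *\<^sub>R B \<in> psd_matrices"
    using AB by (auto simp: psd_matrices_def transpose_def vec_eq_iff
        matrix_vector_mult_add_rdistrib scaleR_matrix_vector_assoc[symmetric] inner_add_right)
qed

lemma convex_design_measures: "convex (design_measures n)"
proof (rule convexI)
  fix \<xi> \<eta> :: "real^'x" and a b :: real
  assume h: "\<xi> \<in> design_measures n" "\<eta> \<in> design_measures n" "0 \<le> a" "0 \<le> b" "a + b = 1"
  have "a * \<xi> $ x + b * \<eta> $ x \<le> 1 / real n" for x
    using h by (intro convex_bound_le) (auto simp: design_measures_def)
  with h show "a *\<^sub>R \<xi> + b *\<^sub>R \<eta> \<in> design_measures n"
    by (auto simp: design_measures_def sum.distrib simp flip: sum_distrib_left)
qed

lemma info_matrix_loewner_concave: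
  assumes A: "C - mat \<kappa> \<in> psd_matrices" and \<kappa>: "0 < \<kappa>" and n: "1 \<le> n"
    and \<xi>: "\<xi> \<in> design_measures n" and \<eta>: "\<eta> \<in> design_measures n"
    and ab: "0 \<le> a" "0 \<le> b" "a + b = 1"
  shows "loewner_le (a *\<^sub>R info_matrix \<kappa> n C F \<xi> + b *\<^sub>R info_matrix \<kappa> n C F \<eta>)
    (info_matrix \<kappa> n C F (a *\<^sub>R \<xi> + b *\<^sub>R \<eta>))"
proof -
  let ?M = "info_matrix \<kappa> n C F" and ?\<zeta> = "a *\<^sub>R \<xi> + b *\<^sub>R \<eta>"
  have \<zeta>: "?\<zeta> \<in> design_measures n"
    using convexD[OF convex_design_measures \<xi> \<eta> ab] .
  have nonneg: "0 \<le> \<theta> $ x" if "\<theta> \<in> design_measures n" for \<theta> x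
    using that by (simp add: design_measures_def)
  note var = info_matrix_variational[OF A \<kappa> n nonneg] and psd = info_matrix_psd[OF A \<kappa> n nonneg]
  have comb: "a *\<^sub>R ?M \<xi> + b *\<^sub>R ?M \<eta> \<in> psd_matrices"
    using convexD[OF convex_psd_matrices psd[OF \<xi>] psd[OF \<eta>] ab] .
  have "u \<bullet> ((a *\<^sub>R ?M \<xi> + b *\<^sub>R ?M \<eta>) *v u) \<le> u \<bullet> (?M ?\<zeta> *v u)" for u
  proof -
    let ?J = "\<lambda>\<theta>. parallel_form \<kappa> n (C - mat \<kappa>) \<theta> (F *v u)"
    \<comment> \<open>The minimiser for the mixed design is a competitor for both
      \<open>\<xi>\<close> and \<open>\<eta>\<close>, even if the three supports differ.\<close>
    obtain g where g: "u \<bullet> (?M ?\<zeta> *v u) = ?J ?\<zeta> g"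
      using var(1)[OF \<zeta>] by blast
    have "u \<bullet> ((a *\<^sub>R ?M \<xi> + b *\<^sub>R ?M \<eta>) *v u) = a * (u \<bullet> (?M \<xi> *v u)) + b * (u \<bullet> (?M \<eta> *v u))"
      by (simp add: matrix_vector_mult_add_rdistrib scaleR_matrix_vector_assoc[symmetric]
          inner_add_right)
    also have "\<dots> \<le> a * ?J \<xi> g + b * ?J \<eta> g"
      using ab var(2)[OF \<xi>] var(2)[OF \<eta>] by (intro add_mono mult_left_mono) auto
    also have "\<dots> = u \<bullet> (?M ?\<zeta> *v u)"
      using ab by (simp add: g parallel_form_affine)
    finally show ?thesis .
  qed
  then show ?thesis
    using comb psd[OF \<zeta>, of F] unfolding loewner_le_def
    by (simp add: psd_matrices_def transpose_def vec_eq_iff matrix_vector_mult_diff_rdistrib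
        inner_diff_right)
qed

theorem theorem1:
  fixes C :: "real^'x^'x" and F :: "real^'p^'x"
    and \<kappa> :: real and n :: nat and \<Phi> :: "real^'p^'p \<Rightarrow> real"
  assumes "1 \<le> n" and "n \<le> CARD('x)"
    and "C \<in> psd_matrices"
    and "0 < \<kappa>" and "\<kappa> < min_eigenvalue C"
    and "concave_on psd_matrices \<Phi>"
    and "monotone_on psd_matrices loewner_le (\<le>) \<Phi>"
    and "continuous_on psd_matrices \<Phi>"
  shows "concave_on (design_measures n) (\<lambda>\<xi>. \<Phi> (info_matrix \<kappa> n C F \<xi>))"
proof -
  let ?M = "info_matrix \<kappa> n C F"
  have sym: "transpose C = C" using assms(3) by (simp add: psd_matrices_def)
  \<comment> \<open>The eigenvalue bound on \<open>\<kappa>\<close> enters here: it keeps the form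
    of \<open>C\<close> above \<open>\<kappa> * (v \<bullet> v)\<close>.\<close>
  have A: "C - mat \<kappa> \<in> psd_matrices"
  proof (rule psd_matricesI)
    fix v :: "real^'x"
    have "\<kappa> * (v \<bullet> v) \<le> min_eigenvalue C * (v \<bullet> v)"
      using assms(5) by (intro mult_right_mono) auto
    then show "0 \<le> v \<bullet> ((C - mat \<kappa>) *v v)"
      using min_eigenvalue_le_rayleigh[OF sym, of v] by (simp add: quadratic_form_shift)
  qed (rule transpose_diff_mat[OF sym])
  have psd: "?M \<xi> \<in> psd_matrices" if "\<xi> \<in> design_measures n" for \<xi>
    using that by (intro info_matrix_psd[OF A assms(4,1)]) (simp add: design_measures_def)
  show ?thesis
    unfolding concave_on_iff
  proof (intro conjI convex_design_measures ballI allI impI)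
    fix \<xi> \<eta> :: "real^'x" and a b :: real
    assume \<xi>: "\<xi> \<in> design_measures n" and \<eta>: "\<eta> \<in> design_measures n"
      and ab: "0 \<le> a" "0 \<le> b" "a + b = 1"
    \<comment> \<open>Concavity of \<open>\<Phi>\<close> passes to the mixture of the information
      matrices; monotonicity then passes to the information matrix of the mixture.\<close>
    have "a * \<Phi> (?M \<xi>) + b * \<Phi> (?M \<eta>) \<le> \<Phi> (a *\<^sub>R ?M \<xi> + b *\<^sub>R ?M \<eta>)"
      using assms(6) psd[OF \<xi>] psd[OF \<eta>] ab unfolding concave_on_iff by blast
    also have "\<dots> \<le> \<Phi> (?M (a *\<^sub>R \<xi> + b *\<^sub>R \<eta>))"
      using convexD[OF convex_psd_matrices psd[OF \<xi>] psd[OF \<eta>] ab]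
        psd[OF convexD[OF convex_design_measures \<xi> \<eta> ab]]
        info_matrix_loewner_concave[OF A assms(4,1) \<xi> \<eta> ab]
      by (rule monotone_onD[OF assms(7)])
    finally show "a * \<Phi> (?M \<xi>) + b * \<Phi> (?M \<eta>) \<le> \<Phi> (?M (a *\<^sub>R \<xi> + b *\<^sub>R \<eta>))" .
  qed
qed

end
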